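(* There is an absolute constant $c$ such that every Boolean function $F$ of $n$ variables with SDD width $\mathsf{sdw}(F)=k$ is computed by a canonical SDD with at most $c\,k\,n$ gates (i.e. $F$ has canonical SDD size $O(kn)$).
   Context: Boolean functions: $F\colon\{0,1\}^X\to\{0,1\}$, $\mathsf{sat}(F)=F^{-1}(1)$. For $Y$ a set of variables and $b\colon Y\cap X\to\{0,1\}$, the cofactor $F(b,X\setminus Y)$ is $b'\mapsto F(b\cup b')$. A function $G$ on $\{0,1\}^{Y\cap X}$ is a factor of $F$ relative to $Y$ if for some cofactor $F'$ induced by an assignment of $Y\cap X$, $G(b)=1$ iff $F(b,X\setminus Y)=F'$; $\mathsf{factors}(F,Y)$ is the set of factors. For disjoint $Y,Y'\subseteq X$ and $H\in\mathsf{factors}(F,Y\cup Y')$, $\mathsf{impl}(F,H,Y,Y')$ is the set of pairs $(G,G')\in\mathsf{factors}(F,Y)\times\mathsf{factors}(F,Y')$ with $\mathsf{sat}(G)\times\mathsf{sat}(G')\subseteq\mathsf{sat}(H)$ ($B\times B'=\{b\cup b'\}$). Circuits: DAGs with input gates labelled by distinct variables or constants, internal unbounded-fanin $\wedge,\vee$ and fanin-1 $\neg$ gates; size = number of gates; NNF: $\neg$ only on inputs; $\mathsf{var}(C_g)$ variables of subcircuit at $g$; deterministic: inputs of each $\vee$-gate have pairwise disjoint models. Vtree for $Y$: rooted ordered binary tree with leaves in bijection with $Y$; $T_v$, $Y_v$ subtree at $v$ and its leaves. A fanin-2 $\wedge$-gate with inputs $h,h'$ is structured by node $v$ with children $v_l,v_r$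 if $\mathsf{var}(C_h)\subseteq Y_{v_l}$, $\mathsf{var}(C_{h'})\subseteq Y_{v_r}$. An SDD structured by $T$: a constant; a literal; or a deterministic NNF $\bigvee_{i\in[m]}(P_i\wedge S_i)$ with a node $v$ (children $w,w'$) structuring every displayed $\wedge$-gate, $P_i$ SDDs structured by $T_w$, $S_i$ SDDs structured by $T_{w'}$, $\bigvee_iP_i\equiv\top$, $P_i\wedge P_j\equiv\bot$ for $i\neq j$; canonical if additionally (recursively) $S_i\not\equiv S_j$ for $i\neq j$. Construction (for $T$ a vtree for $X$ whose non-leaf nodes have two children): for disjoint $Y,Y'$ and $\mathcal{H}\subseteq\mathsf{factors}(F,Y\cup Y')$, for $G\in\mathsf{factors}(F,Y)$ let $\mathcal{S}_G=\{G':(G,G')\in\mathsf{impl}(F,H,Y,Y'),H\in\mathcal{H}\}$; with $\mathcal{S}_1,\dots,\mathcal{S}_m$ the distinct such sets and $\mathcal{P}_i=\{G:\mathcal{S}_G=\mathcal{S}_i\}$, let $\mathsf{sd}(F,\mathcal{H},Y,Y')=\{(\mathcal{P}_i,\mathcal{S}_i)\}$. For $v\in T$, $\mathcal{H}\subseteq\mathsf{factors}(F,X_v)$: at a leaf $x$ with $F(0,X\setminus\{x\})=F(1,X\setminus\{x\})$, $\mathsf{factors}(F,\{x\})=\{H\}$, $C_{v,\emptyset}=\bot$, $C_{v,\{H\}}=\top$; otherwise $\mathsf{factors}(F,\{x\})=\{H_0,H_1\}$ with $\mathsf{sat}(H_c)=\{x\mapsto c\}$ and $C_{v,\emptyset}=\bot$,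 $C_{v,\{H_0\}}=\neg x$, $C_{v,\{H_1\}}=x$, $C_{v,\{H_0,H_1\}}=\top$. At $v$ with children $w,w'$: $C_{v,\mathcal{H}}=\bigvee_{(\mathcal{P},\mathcal{S})\in\mathsf{sd}(F,\mathcal{H},X_w,X_{w'})}(C_{w,\mathcal{P}}\wedge C_{w',\mathcal{S}})$. Let $S_{F,T}=C_{r,\{F\}}$, $r$ the root. SDD width: $\mathsf{sdw}(F,T)$ is the maximum over $v\in T$ of the number of $\wedge$-gates of $S_{F,T}$ structured by $v$, and $\mathsf{sdw}(F)=\min_T\mathsf{sdw}(F,T)$ over vtrees $T$ for $X$.
   Formalization: The bound is c·max(1,k)·n instead of c·k·n, because for n=1 the SDD width is 0 while every circuit has a gate (for n≥2 always k≥1, so nothing changes); n≥1 is assumed since no vtree exists for n=0, and variables are named by natural numbers. *)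

theory Defs
  imports Main "HOL-Library.FSet"
begin

text \<open>
  An element of \<open>{0,1}\<^sup>X\<close> is a partial map with domain \<open>X\<close>, so that \<open>b \<union> b'\<close> is \<open>b ++ b'\<close> for
  disjoint domains. A Boolean function on \<open>{0,1}\<^sup>X\<close> is extended by \<open>False\<close> outside \<open>{0,1}\<^sup>X\<close>;
  hence equality of functions with the same variables is HOL equality. As \<open>X\<close> cannot be recovered
  from the function, it is passed as a separate argument.
\<close>

type_synonym 'v assignment = "'v \<rightharpoonup> bool"
type_synonym 'v boolfun = "'v assignment \<Rightarrow> bool"

definition assignments :: "'v set \<Rightarrow> 'v assignment set" where
  "assignments X = {b. dom b = X}"

definition boolfuns :: "'v set \<Rightarrow> 'v boolfun set" where
  "boolfuns X = {F. \<forall>b. F b \<longrightarrow> b \<in> assignments X}"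

definition sat :: "'v boolfun \<Rightarrow> 'v assignment set" where
  "sat F = {b. F b}"

definition cofactor :: "'v set \<Rightarrow> 'v boolfun \<Rightarrow> 'v set \<Rightarrow> 'v assignment \<Rightarrow> 'v boolfun" where
  "cofactor X F Y b = (\<lambda>b'. b' \<in> assignments (X - Y) \<and> F (b ++ b'))"

definition factors :: "'v set \<Rightarrow> 'v boolfun \<Rightarrow> 'v set \<Rightarrow> 'v boolfun set" where
  "factors X F Y =
    {G \<in> boolfuns (Y \<inter> X). \<exists>F' \<in> cofactor X F Y ` assignments (Y \<inter> X).
       \<forall>b \<in> assignments (Y \<inter> X). G b \<longleftrightarrow> cofactor X F Y b = F'}"

definition impl ::
  "'v set \<Rightarrow> 'v boolfun \<Rightarrow> 'v boolfun \<Rightarrow> 'v set \<Rightarrow> 'v set \<Rightarrow> ('v boolfun \<times> 'v boolfun) set" where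
  "impl X F H Y Y' =
    {(G, G'). G \<in> factors X F Y \<and> G' \<in> factors X F Y' \<and>
       {b ++ b' |b b'. b \<in> sat G \<and> b' \<in> sat G'} \<subseteq> sat H}"

definition sd_sub ::
  "'v set \<Rightarrow> 'v boolfun \<Rightarrow> 'v boolfun set \<Rightarrow> 'v set \<Rightarrow> 'v set \<Rightarrow> 'v boolfun \<Rightarrow> 'v boolfun set" where
  "sd_sub X F \<H> Y Y' G = {G'. \<exists>H \<in> \<H>. (G, G') \<in> impl X F H Y Y'}"

definition sd ::
  "'v set \<Rightarrow> 'v boolfun \<Rightarrow> 'v boolfun set \<Rightarrow> 'v set \<Rightarrow> 'v set
    \<Rightarrow> ('v boolfun set \<times> 'v boolfun set) set" where
  "sd X F \<H> Y Y' =
    (\<lambda>S. ({G \<in> factors X F Y. sd_sub X F \<H> Y Y' G = S}, S)) `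
      sd_sub X F \<H> Y Y' ` factors X F Y"

text \<open>
  The circuit DAG is represented with maximal sharing: a gate is identified with the subcircuit
  rooted at it, so the gates of a circuit are its distinct subterms. The inputs of an
  \<open>And\<close>-gate are ordered because structuredness distinguishes its left and right input.
\<close>

datatype 'v circuit =
    Const bool
  | Var 'v
  | Neg "'v circuit"
  | And "'v circuit list"
  | Or "'v circuit fset"

primrec gates :: "'v circuit \<Rightarrow> 'v circuit set" where
  "gates (Const c) = {Const c}"
| "gates (Var x) = {Var x}"
| "gates (Neg C) = insert (Neg C) (gates C)"
| "gates (And Cs) = insert (And Cs) (\<Union> (set (map gates Cs)))"
| "gates (Or Cs) = insert (Or Cs) (\<Union> (fset (fimage gates Cs)))"

definition circuit_size :: "'v circuit \<Rightarrow> nat" where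
  "circuit_size C = card (gates C)"

definition vars :: "'v circuit \<Rightarrow> 'v set" where
  "vars C = {x. Var x \<in> gates C}"

primrec eval :: "('v \<Rightarrow> bool) \<Rightarrow> 'v circuit \<Rightarrow> bool" where
  "eval a (Const c) = c"
| "eval a (Var x) = a x"
| "eval a (Neg C) = (\<not> eval a C)"
| "eval a (And Cs) = (\<forall>e \<in> set (map (eval a) Cs). e)"
| "eval a (Or Cs) = (\<exists>e \<in> fset (fimage (eval a) Cs). e)"

definition computes :: "'v circuit \<Rightarrow> 'v set \<Rightarrow> 'v boolfun \<Rightarrow> bool" where
  "computes C X F \<longleftrightarrow> vars C \<subseteq> X \<and> (\<forall>a. eval a C \<longleftrightarrow> F ((Some \<circ> a) |` X))"

definition nnf :: "'v circuit \<Rightarrow> bool" where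
  "nnf C \<longleftrightarrow> (\<forall>h. Neg h \<in> gates C \<longrightarrow> (\<exists>x. h = Var x) \<or> (\<exists>c. h = Const c))"

definition deterministic :: "'v circuit \<Rightarrow> bool" where
  "deterministic C \<longleftrightarrow>
    (\<forall>Hs. Or Hs \<in> gates C \<longrightarrow>
      (\<forall>h h'. h |\<in>| Hs \<longrightarrow> h' |\<in>| Hs \<longrightarrow> h \<noteq> h' \<longrightarrow> (\<nexists>a. eval a h \<and> eval a h')))"

text \<open>
  Since the leaves of a vtree are pairwise distinct, a node \<open>v\<close> is identified with the subtree
  rooted at it.
\<close>

datatype 'v vtree = Leaf 'v | Node "'v vtree" "'v vtree"

primrec leaf_list :: "'v vtree \<Rightarrow> 'v list" where
  "leaf_list (Leaf x) = [x]"
| "leaf_list (Node l r) = leaf_list l @ leaf_list r"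

definition leaves :: "'v vtree \<Rightarrow> 'v set" where
  "leaves T = set (leaf_list T)"

definition vtree_for :: "'v set \<Rightarrow> 'v vtree \<Rightarrow> bool" where
  "vtree_for X T \<longleftrightarrow> distinct (leaf_list T) \<and> leaves T = X"

primrec nodes :: "'v vtree \<Rightarrow> 'v vtree set" where
  "nodes (Leaf x) = {Leaf x}"
| "nodes (Node l r) = insert (Node l r) (nodes l \<union> nodes r)"

definition structured_by :: "'v circuit \<Rightarrow> 'v vtree \<Rightarrow> bool" where
  "structured_by g v \<longleftrightarrow>
    (\<exists>h h' l r. g = And [h, h'] \<and> v = Node l r \<and> vars h \<subseteq> leaves l \<and> vars h' \<subseteq> leaves r)"

definition decision :: "('v circuit \<times> 'v circuit) fset \<Rightarrow> 'v circuit" where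
  "decision D = Or ((\<lambda>(P, S). And [P, S]) |`| D)"

inductive sdd :: "'v vtree \<Rightarrow> 'v circuit \<Rightarrow> bool" where
  sdd_const: "sdd T (Const c)"
| sdd_pos: "x \<in> leaves T \<Longrightarrow> sdd T (Var x)"
| sdd_neg: "x \<in> leaves T \<Longrightarrow> sdd T (Neg (Var x))"
| sdd_decision: "\<lbrakk>nnf (decision D); deterministic (decision D);
     Node w w' \<in> nodes T;
     \<And>P S. (P, S) |\<in>| D \<Longrightarrow> structured_by (And [P, S]) (Node w w');
     \<And>P S. (P, S) |\<in>| D \<Longrightarrow> sdd w P;
     \<And>P S. (P, S) |\<in>| D \<Longrightarrow> sdd w' S;
     \<And>a. \<exists>P S. (P, S) |\<in>| D \<and> eval a P;
     \<And>a P S P' S'. \<lbrakk>(P, S) |\<in>| D; (P', S') |\<in>| D; (P, S) \<noteq> (P', S')\<rbrakk>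
        \<Longrightarrow> \<not> (eval a P \<and> eval a P')\<rbrakk>
   \<Longrightarrow> sdd T (decision D)"

text \<open>
  Every \<open>Or\<close>-gate of an SDD is the output of one of its recursively nested decisions, so the
  recursive canonicity condition ranges over all \<open>Or\<close>-gates.
\<close>

definition canonical_sdd :: "'v vtree \<Rightarrow> 'v circuit \<Rightarrow> bool" where
  "canonical_sdd T C \<longleftrightarrow> sdd T C \<and>
    (\<forall>D. decision D \<in> gates C \<longrightarrow>
      (\<forall>P S P' S'. (P, S) |\<in>| D \<longrightarrow> (P', S') |\<in>| D \<longrightarrow> (P, S) \<noteq> (P', S') \<longrightarrow>
        (\<exists>a. eval a S \<noteq> eval a S')))"

text \<open>
  \<open>sdd_constr X F v \<H>\<close> is the circuit \<open>C\<^bsub>v,\<H>\<^esub>\<close>. The last alternative at a leaf covers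
  \<open>\<H> = \<emptyset>\<close>, and also \<open>\<H> = {F}\<close> for \<open>F \<equiv> \<bottom>\<close>, which is not a set of factors of \<open>F\<close>.
  For finite \<open>X\<close>, \<open>sd\<close> is finite, so \<open>Abs_fset\<close> is applied to a finite set.
\<close>

primrec sdd_constr ::
  "'v set \<Rightarrow> 'v boolfun \<Rightarrow> 'v vtree \<Rightarrow> 'v boolfun set \<Rightarrow> 'v circuit" where
  "sdd_constr X F (Leaf x) \<H> =
    (let H = (\<lambda>c b. b = [x \<mapsto> c]) in
     if cofactor X F {x} [x \<mapsto> False] = cofactor X F {x} [x \<mapsto> True] then
       (if \<H> = factors X F {x} then Const True else Const False)
     else if \<H> = {H False} then Neg (Var x)
     else if \<H> = {H True} then Var x
     else if \<H> = {H False, H True} then Const True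
     else Const False)"
| "sdd_constr X F (Node w w') \<H> =
    decision (Abs_fset ((\<lambda>(P, S). (sdd_constr X F w P, sdd_constr X F w' S)) `
      sd X F \<H> (leaves w) (leaves w')))"

definition sdd_of :: "'v set \<Rightarrow> 'v boolfun \<Rightarrow> 'v vtree \<Rightarrow> 'v circuit" where
  "sdd_of X F T = sdd_constr X F T {F}"

definition sdw_vtree :: "'v set \<Rightarrow> 'v boolfun \<Rightarrow> 'v vtree \<Rightarrow> nat" where
  "sdw_vtree X F T = Max ((\<lambda>v. card {g \<in> gates (sdd_of X F T). structured_by g v}) ` nodes T)"

definition sdw :: "'v set \<Rightarrow> 'v boolfun \<Rightarrow> nat" where
  "sdw X F = (LEAST k. \<exists>T. vtree_for X T \<and> sdw_vtree X F T = k)"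

end

theory Submission
  imports Defs
begin

text \<open>
  For a vtree \<open>T\<close> attaining the width, the circuit \<open>S\<^bsub>F,T\<^esub>\<close> itself is the desired canonical SDD.
  The factors of \<open>F\<close> relative to \<open>Y\<close> are the classes of the equivalence relation on
  \<open>{0,1}\<^sup>Y\<close> that identifies assignments with equal cofactors, and this relation is a congruence for
  \<open>b \<union> b'\<close>; hence \<open>C\<^bsub>v,\<H>\<^esub>\<close> computes the union of the classes in \<open>\<H>\<close>. So different sets of
  factors give inequivalent circuits, which yields canonicity. For the size, every \<open>\<and>\<close>-gate is
  structured by one of the \<open>O(n)\<close> nodes of \<open>T\<close>, and every other gate is the output, a constant,
  a literal, or one of the two inputs of an \<open>\<and>\<close>-gate.
\<close>

section \<open>Factors as equivalence classes\<close>

text \<open>The class of \<open>b\<close> as a characteristic function. The conjunct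
  \<open>c \<in> assignments Y\<close> puts it into \<open>boolfuns Y\<close>, so that equality of
  classes is equality of functions.\<close>

definition factor_of :: "'v set \<Rightarrow> 'v boolfun \<Rightarrow> 'v set \<Rightarrow> 'v assignment \<Rightarrow> 'v boolfun" where
  "factor_of X F Y b = (\<lambda>c. c \<in> assignments Y \<and> cofactor X F Y c = cofactor X F Y b)"

lemma factors_eq_image_factor_of:
  assumes "Y \<subseteq> X"
  shows "factors X F Y = factor_of X F Y ` assignments Y"
proof -
  have YX: "Y \<inter> X = Y"
    using assms by blast
  show ?thesis
    unfolding factors_def YX
  proof (intro equalityI subsetI)
    fix G assume "G \<in> {G \<in> boolfuns Y. \<exists>F' \<in> cofactor X F Y ` assignments Y.
       \<forall>b \<in> assignments Y. G b \<longleftrightarrow> cofactor X F Y b = F'}"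
    then obtain b where G: "G \<in> boolfuns Y" and b: "b \<in> assignments Y"
      and eq: "\<forall>c \<in> assignments Y. G c \<longleftrightarrow> cofactor X F Y c = cofactor X F Y b"
      by blast
    have "G = factor_of X F Y b"
      using G eq by (auto simp: factor_of_def boolfuns_def)
    then show "G \<in> factor_of X F Y ` assignments Y"
      using b by blast
  next
    fix G assume "G \<in> factor_of X F Y ` assignments Y"
    then show "G \<in> {G \<in> boolfuns Y. \<exists>F' \<in> cofactor X F Y ` assignments Y.
       \<forall>b \<in> assignments Y. G b \<longleftrightarrow> cofactor X F Y b = F'}"
      by (auto simp: factor_of_def boolfuns_def)
  qed
qed

lemma factor_of_in_factors:
  "Y \<subseteq> X \<Longrightarrow> b \<in> assignments Y \<Longrightarrow> factor_of X F Y b \<in> factors X F Y"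
  by (simp add: factors_eq_image_factor_of)

lemma factor_of_self: "b \<in> assignments Y \<Longrightarrow> factor_of X F Y b b"
  by (simp add: factor_of_def)

lemma factor_eq_factor_of:
  assumes "Y \<subseteq> X" "G \<in> factors X F Y" "G b"
  shows "G = factor_of X F Y b"
  using assms by (auto simp: factors_eq_image_factor_of factor_of_def)

lemma factor_assignments:
  assumes "Y \<subseteq> X" "G \<in> factors X F Y" "G b"
  shows "b \<in> assignments Y"
  using assms by (auto simp: factors_eq_image_factor_of factor_of_def)

lemma factor_satisfiable:
  assumes "Y \<subseteq> X" "G \<in> factors X F Y"
  shows "\<exists>b \<in> assignments Y. G b"
  using assms by (auto simp: factors_eq_image_factor_of intro: factor_of_self)

lemma factor_cofactor_eq:
  assumes "Y \<subseteq> X" "G \<in> factors X F Y" "G b" "G c"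
  shows "cofactor X F Y b = cofactor X F Y c"
  using assms by (auto simp: factors_eq_image_factor_of factor_of_def)

lemma finite_assignments:
  assumes "finite X"
  shows "finite (assignments X)"
  using finite_set_of_finite_maps[OF assms, of "UNIV :: bool set"]
  by (simp add: assignments_def)

lemma finite_factors: "finite X \<Longrightarrow> Y \<subseteq> X \<Longrightarrow> finite (factors X F Y)"
  by (metis factors_eq_image_factor_of finite_assignments finite_imageI finite_subset)

text \<open>Reassociation suffices: extending \<open>b ++ b'\<close> by \<open>e\<close> is
  extending \<open>b\<close> by \<open>b' ++ e\<close>, which assigns exactly
  \<open>X - Y\<close>.\<close>

lemma cofactor_map_add_cong:
  assumes sub: "Y' \<subseteq> X" and disj: "Y \<inter> Y' = {}"
    and b': "b' \<in> assignments Y'"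
    and eq: "cofactor X F Y b = cofactor X F Y c"
  shows "cofactor X F (Y \<union> Y') (b ++ b') = cofactor X F (Y \<union> Y') (c ++ b')"
proof
  fix e
  show "cofactor X F (Y \<union> Y') (b ++ b') e = cofactor X F (Y \<union> Y') (c ++ b') e"
  proof (cases "e \<in> assignments (X - (Y \<union> Y'))")
    case True
    then have "b' ++ e \<in> assignments (X - Y)"
      using b' sub disj by (auto simp: assignments_def)
    then have "F (b ++ (b' ++ e)) = F (c ++ (b' ++ e))"
      using fun_cong[OF eq, of "b' ++ e"] by (simp add: cofactor_def)
    then show ?thesis
      by (simp add: cofactor_def)
  next
    case False
    then show ?thesis
      by (simp add: cofactor_def)
  qed
qed

text \<open>One half is exchanged at a time; since \<open>++\<close> commutes on disjoint domains,
  the one-sided congruence also applies to the right half.\<close>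

lemma cofactor_map_add_cong2:
  assumes sub: "Y \<subseteq> X" "Y' \<subseteq> X" and disj: "Y \<inter> Y' = {}"
    and dom: "b \<in> assignments Y" "c \<in> assignments Y" "b' \<in> assignments Y'" "c' \<in> assignments Y'"
    and eq: "cofactor X F Y b = cofactor X F Y c"
    and eq': "cofactor X F Y' b' = cofactor X F Y' c'"
  shows "cofactor X F (Y \<union> Y') (b ++ b') = cofactor X F (Y \<union> Y') (c ++ c')"
proof -
  have "cofactor X F (Y \<union> Y') (b ++ b') = cofactor X F (Y \<union> Y') (c ++ b')"
    by (rule cofactor_map_add_cong) (use assms in auto)
  also have "\<dots> = cofactor X F (Y' \<union> Y) (b' ++ c)"
    using dom disj by (simp add: assignments_def Un_commute map_add_comm)
  also have "\<dots> = cofactor X F (Y' \<union> Y) (c' ++ c)"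
    by (rule cofactor_map_add_cong) (use assms in auto)
  also have "\<dots> = cofactor X F (Y \<union> Y') (c ++ c')"
    using dom disj by (simp add: assignments_def Un_commute map_add_comm Int_commute)
  finally show ?thesis .
qed

section \<open>Implicants and sentential decompositions\<close>

lemma implD:
  assumes "(G, G') \<in> impl X F H Y Y'" "G b" "G' b'"
  shows "H (b ++ b')"
proof -
  have "b ++ b' \<in> {b ++ b' |b b'. b \<in> sat G \<and> b' \<in> sat G'}"
    using assms(2,3) unfolding sat_def by blast
  moreover have "{b ++ b' |b b'. b \<in> sat G \<and> b' \<in> sat G'} \<subseteq> sat H"
    using assms(1) by (simp add: impl_def)
  ultimately have "b ++ b' \<in> sat H"
    by (rule rev_subsetD)
  then show ?thesis
    by (simp add: sat_def)
qed

text \<open>By congruence, the product of a class of \<open>Y\<close> and a class of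
  \<open>Y'\<close> lies inside a single class of \<open>Y \<union> Y'\<close>. One pair of
  representatives therefore decides whether the product lies in \<open>H\<close>.\<close>

lemma impl_iff:
  assumes sub: "Y \<subseteq> X" "Y' \<subseteq> X" and disj: "Y \<inter> Y' = {}"
    and H: "H \<in> factors X F (Y \<union> Y')"
    and G: "G \<in> factors X F Y" "G b" and G': "G' \<in> factors X F Y'" "G' b'"
  shows "(G, G') \<in> impl X F H Y Y' \<longleftrightarrow> H (b ++ b')"
proof
  assume "(G, G') \<in> impl X F H Y Y'"
  then show "H (b ++ b')"
    using G(2) G'(2) by (rule implD)
next
  assume Hb: "H (b ++ b')"
  have "H (c ++ c')" if c: "G c" "G' c'" for c c'
  proof -
    have ass: "b \<in> assignments Y" "c \<in> assignments Y" "b' \<in> assignments Y'" "c' \<in> assignments Y'"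
      using factor_assignments[of _ X _ F] sub G G' c by metis+
    have "cofactor X F (Y \<union> Y') (c ++ c') = cofactor X F (Y \<union> Y') (b ++ b')"
      using ass factor_cofactor_eq[of Y X G F c b] factor_cofactor_eq[of Y' X G' F c' b'] sub G G' c
      by (intro cofactor_map_add_cong2[OF sub disj]) simp_all
    moreover have "c ++ c' \<in> assignments (Y \<union> Y')"
      using ass by (auto simp: assignments_def)
    moreover have "H = factor_of X F (Y \<union> Y') (b ++ b')"
      using factor_eq_factor_of[of "Y \<union> Y'" X H F "b ++ b'"] sub H Hb by blast
    ultimately show ?thesis
      by (simp add: factor_of_def)
  qed
  then show "(G, G') \<in> impl X F H Y Y'"
    using G(1) G'(1) by (auto simp: impl_def sat_def)
qed

lemma sd_subset_factors:
  assumes "(P, S) \<in> sd X F \<H> Y Y'"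
  shows "P \<subseteq> factors X F Y" "S \<subseteq> factors X F Y'"
  using assms by (auto simp: sd_def sd_sub_def impl_def)

text \<open>\<open>sd\<close> lists the fibres of \<open>sd_sub\<close> together with their values,
  so a value determines its fibre. Distinct pairs thus have distinct second components, from which
  canonicity will follow.\<close>

lemma sd_eq_if_same_sub:
  assumes "(P, S) \<in> sd X F \<H> Y Y'" "(P', S) \<in> sd X F \<H> Y Y'"
  shows "P = P'"
  using assms by (auto simp: sd_def)

text \<open>Two fibres of \<open>sd_sub\<close> that share a point coincide; this makes the primes
  disjoint.\<close>

lemma sd_eq_if_common_prime:
  assumes "(P, S) \<in> sd X F \<H> Y Y'" "(P', S') \<in> sd X F \<H> Y Y'" "G \<in> P" "G \<in> P'"
  shows "P = P'" "S = S'"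
  using assms by (auto simp: sd_def)

lemma finite_sd: "finite X \<Longrightarrow> Y \<subseteq> X \<Longrightarrow> finite (sd X F \<H> Y Y')"
  by (simp add: sd_def finite_factors)

text \<open>\<open>p\<close> and \<open>q\<close> stand for evaluation at a fixed assignment. Each
  factor \<open>G\<close> lies in exactly one prime set, whose sub set consists of all partners of
  \<open>G\<close>, so choosing a pair in \<open>sd\<close> amounts to choosing
  \<open>G\<close>.\<close>

lemma ex_sd_iff:
  "(\<exists>(P, S) \<in> sd X F \<H> Y Y'. (\<exists>G \<in> P. p G) \<and> (\<exists>G' \<in> S. q G')) \<longleftrightarrow>
    (\<exists>G \<in> factors X F Y. p G \<and> (\<exists>H \<in> \<H>. \<exists>G'. (G, G') \<in> impl X F H Y Y' \<and> q G'))"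
  by (fastforce simp: sd_def sd_sub_def)

section \<open>Total valuations versus assignments, and factors of one variable\<close>

lemma restrict_in_assignments: "(Some \<circ> a) |` Y \<in> assignments Y"
  by (auto simp: assignments_def)

lemma restrict_Un: "(Some \<circ> a) |` (Y \<union> Y') = (Some \<circ> a) |` Y ++ (Some \<circ> a) |` Y'"
  by (auto simp: restrict_map_def map_add_def fun_eq_iff)

text \<open>Links circuits, evaluated at total valuations, with factors, evaluated at partial maps.
  \<open>the \<circ> b\<close> is arbitrary outside \<open>Y\<close>, but the restriction removes
  those values.\<close>

lemma assignment_eq_restrict:
  assumes "b \<in> assignments Y"
  shows "(Some \<circ> (the \<circ> b)) |` Y = b"
  using assms by (force simp: assignments_def restrict_map_def fun_eq_iff)

lemma assignments_singleton: "assignments {x} = {[x \<mapsto> False], [x \<mapsto> True]}"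
proof (intro equalityI subsetI)
  fix b :: "'a assignment" assume "b \<in> assignments {x}"
  then obtain c where "b = [x \<mapsto> c]"
    unfolding assignments_def mem_Collect_eq dom_eq_singleton_conv by blast
  then show "b \<in> {[x \<mapsto> False], [x \<mapsto> True]}"
    by (cases c) auto
qed (auto simp: assignments_def split: if_splits)

lemma upd_eq_upd_iff: "[x \<mapsto> c] = [x \<mapsto> d] \<longleftrightarrow> c = d"
  by (metis fun_upd_same option.inject)

lemma factors_singleton_eq:
  assumes "x \<in> X" "cofactor X F {x} [x \<mapsto> False] = cofactor X F {x} [x \<mapsto> True]"
  shows "factors X F {x} = {\<lambda>b. b \<in> assignments {x}}"
proof -
  have eq: "cofactor X F {x} b = cofactor X F {x} [x \<mapsto> True]" if "b \<in> assignments {x}" for b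
    using assms(2) that by (auto simp only: assignments_singleton)
  have "factor_of X F {x} b = (\<lambda>c. c \<in> assignments {x})" if "b \<in> assignments {x}" for b
    unfolding factor_of_def eq[OF that] using eq by (intro ext) blast
  then have "factor_of X F {x} ` assignments {x} = (\<lambda>_ c. c \<in> assignments {x}) ` assignments {x}"
    by (rule image_cong[OF refl])
  also have "\<dots> = {\<lambda>c. c \<in> assignments {x}}"
    by (rule image_constant[of "[x \<mapsto> True]"]) (simp add: assignments_singleton)
  finally show ?thesis
    using assms(1) by (simp add: factors_eq_image_factor_of)
qed

lemma factors_singleton_neq:
  assumes "x \<in> X" "cofactor X F {x} [x \<mapsto> False] \<noteq> cofactor X F {x} [x \<mapsto> True]"
  shows "factors X F {x} = {\<lambda>b. b = [x \<mapsto> False], \<lambda>b. b = [x \<mapsto> True]}"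
proof -
  have "factor_of X F {x} [x \<mapsto> c] b \<longleftrightarrow> b = [x \<mapsto> c]" for c b
    unfolding factor_of_def assignments_singleton
    using assms(2) by (cases c) (metis empty_iff insert_iff)+
  then have "factor_of X F {x} [x \<mapsto> c] = (\<lambda>b. b = [x \<mapsto> c])" for c
    by blast
  then show ?thesis
    using assms(1) by (simp add: factors_eq_image_factor_of assignments_singleton)
qed

section \<open>Semantics of the construction\<close>

lemma leaves_simps [simp]:
  "leaves (Leaf x) = {x}"
  "leaves (Node l r) = leaves l \<union> leaves r"
  by (simp_all add: leaves_def)

lemma eval_decision: "eval a (decision D) \<longleftrightarrow> (\<exists>(P, S) \<in> fset D. eval a P \<and> eval a S)"
  by (force simp: decision_def)

lemma fset_Abs_fset_sd_image:
  assumes "finite X" "Y \<subseteq> X"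
  shows "fset (Abs_fset (f ` sd X F \<H> Y Y')) = f ` sd X F \<H> Y Y'"
  using assms by (simp add: Abs_fset_inverse finite_sd)

text \<open>Induction on the vtree. At an inner node, \<open>a\<close> selects one class on each
  side; by \<open>impl_iff\<close> their product lies in \<open>H\<close> exactly if the restriction
  of \<open>a\<close> satisfies \<open>H\<close>, and some pair of \<open>sd\<close> contains both
  classes exactly if this happens for some \<open>H\<close> in \<open>\<H>\<close>.\<close>

lemma eval_sdd_constr:
  assumes "finite X" "distinct (leaf_list v)" "leaves v \<subseteq> X" "\<H> \<subseteq> factors X F (leaves v)"
  shows "eval a (sdd_constr X F v \<H>) \<longleftrightarrow> (\<exists>H \<in> \<H>. H ((Some \<circ> a) |` leaves v))"
  using assms(2-4)
proof (induction v arbitrary: \<H>)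
  case (Leaf x)
  have x: "x \<in> X"
    using Leaf by simp
  have "(Some \<circ> a) |` {x} = [x \<mapsto> a x]"
    by (auto simp: restrict_map_def)
  then have ax: "(Some \<circ> a) |` leaves (Leaf x) = [x \<mapsto> a x]"
    by simp
  define H where "H = (\<lambda>(c :: bool) b. b = [x \<mapsto> c])"
  have H_a: "H c ((Some \<circ> a) |` leaves (Leaf x)) \<longleftrightarrow> a x = c" for c
    unfolding H_def ax by (rule upd_eq_upd_iff)
  have H_neq: "H True \<noteq> H False"
    unfolding H_def by (metis upd_eq_upd_iff)
  show ?case
  proof (cases "cofactor X F {x} [x \<mapsto> False] = cofactor X F {x} [x \<mapsto> True]")
    case True
    then have "\<H> = {} \<or> \<H> = {\<lambda>b. b \<in> assignments {x}}"
      using Leaf.prems(3) factors_singleton_eq[OF x] by auto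
    then show ?thesis
      unfolding ax using True factors_singleton_eq[OF x True]
      by (cases "a x") (auto simp: assignments_singleton)
  next
    case False
    then have "factors X F {x} = {H False, H True}"
      unfolding H_def by (rule factors_singleton_neq[OF x])
    then have "\<H> = {} \<or> \<H> = {H False} \<or> \<H> = {H True} \<or> \<H> = {H False, H True}"
      using Leaf.prems(3) by auto
    moreover have "sdd_constr X F (Leaf x) \<H> =
      (if \<H> = {H False} then Neg (Var x) else if \<H> = {H True} then Var x
       else if \<H> = {H False, H True} then Const True else Const False)"
      unfolding sdd_constr.simps Let_def H_def using False by (simp only: if_False)
    ultimately show ?thesis
      using H_neq H_neq[symmetric] by (elim disjE) (simp_all add: H_a[unfolded comp_def] del: sdd_constr.simps leaves_simps)
  qed
next
  case (Node w w')
  let ?a = "\<lambda>Y. (Some \<circ> a) |` Y"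
  have sub: "leaves w \<subseteq> X" "leaves w' \<subseteq> X"
    and dist: "distinct (leaf_list w)" "distinct (leaf_list w')"
    and disj: "leaves w \<inter> leaves w' = {}"
    using Node.prems by (auto simp: leaves_def)
  have "eval a (sdd_constr X F (Node w w') \<H>) \<longleftrightarrow>
      (\<exists>(P, S) \<in> sd X F \<H> (leaves w) (leaves w').
        eval a (sdd_constr X F w P) \<and> eval a (sdd_constr X F w' S))"
    by (simp add: eval_decision fset_Abs_fset_sd_image[OF assms(1) sub(1)] case_prod_beta)
  also have "\<dots> \<longleftrightarrow> (\<exists>(P, S) \<in> sd X F \<H> (leaves w) (leaves w').
        (\<exists>G \<in> P. G (?a (leaves w))) \<and> (\<exists>G' \<in> S. G' (?a (leaves w'))))"
  proof (rule bex_cong[OF refl])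
    fix PS assume "PS \<in> sd X F \<H> (leaves w) (leaves w')"
    then obtain P S where PS: "PS = (P, S)" "(P, S) \<in> sd X F \<H> (leaves w) (leaves w')"
      by (metis surj_pair)
    show "(case PS of (P, S) \<Rightarrow> eval a (sdd_constr X F w P) \<and> eval a (sdd_constr X F w' S)) \<longleftrightarrow>
      (case PS of (P, S) \<Rightarrow> (\<exists>G \<in> P. G (?a (leaves w))) \<and> (\<exists>G' \<in> S. G' (?a (leaves w'))))"
      unfolding PS(1) prod.case
        Node.IH(1)[OF dist(1) sub(1) sd_subset_factors(1)[OF PS(2)]]
        Node.IH(2)[OF dist(2) sub(2) sd_subset_factors(2)[OF PS(2)]] ..
  qed
  also have "\<dots> \<longleftrightarrow> (\<exists>G \<in> factors X F (leaves w). G (?a (leaves w)) \<and>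
      (\<exists>H \<in> \<H>. \<exists>G'. (G, G') \<in> impl X F H (leaves w) (leaves w') \<and> G' (?a (leaves w'))))"
    by (rule ex_sd_iff)
  also have "\<dots> \<longleftrightarrow> (\<exists>H \<in> \<H>. H (?a (leaves w) ++ ?a (leaves w')))"
  proof
    assume "\<exists>G \<in> factors X F (leaves w). G (?a (leaves w)) \<and>
      (\<exists>H \<in> \<H>. \<exists>G'. (G, G') \<in> impl X F H (leaves w) (leaves w') \<and> G' (?a (leaves w')))"
    then obtain G H G' where G: "G (?a (leaves w))" "G' (?a (leaves w'))" and H: "H \<in> \<H>"
      and impl: "(G, G') \<in> impl X F H (leaves w) (leaves w')"
      by blast
    show "\<exists>H \<in> \<H>. H (?a (leaves w) ++ ?a (leaves w'))"
      using implD[of G G' X F H "leaves w" "leaves w'"] impl G H by blast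
  next
    assume "\<exists>H \<in> \<H>. H (?a (leaves w) ++ ?a (leaves w'))"
    then obtain H where H: "H \<in> \<H>" "H (?a (leaves w) ++ ?a (leaves w'))"
      by blast
    \<comment> \<open>The witnesses are the classes of the two restrictions of
      \<open>a\<close>.\<close>
    define G where "G = factor_of X F (leaves w) (?a (leaves w))"
    define G' where "G' = factor_of X F (leaves w') (?a (leaves w'))"
    have G: "G \<in> factors X F (leaves w)" "G (?a (leaves w))"
      unfolding G_def
      by (intro factor_of_in_factors factor_of_self sub restrict_in_assignments)+
    have G': "G' \<in> factors X F (leaves w')" "G' (?a (leaves w'))"
      unfolding G'_def
      by (intro factor_of_in_factors factor_of_self sub restrict_in_assignments)+
    have "H \<in> factors X F (leaves w \<union> leaves w')"
      using H(1) Node.prems(3) by auto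
    then have "(G, G') \<in> impl X F H (leaves w) (leaves w')"
      using impl_iff[of "leaves w" X "leaves w'" H F G "?a (leaves w)" G' "?a (leaves w')"]
        sub disj G G' H(2) by blast
    then show "\<exists>G \<in> factors X F (leaves w). G (?a (leaves w)) \<and>
      (\<exists>H \<in> \<H>. \<exists>G'. (G, G') \<in> impl X F H (leaves w) (leaves w') \<and> G' (?a (leaves w')))"
      using G G' H(1) by blast
  qed
  finally show ?case
    by (simp only: leaves_simps restrict_Un)
qed

text \<open>Classes are nonempty and pairwise disjoint, so a set of classes can be recovered from
  its union, and this union is what the circuit computes.\<close>

lemma sdd_constr_inequivalent:
  assumes "finite X" "distinct (leaf_list v)" "leaves v \<subseteq> X"
    and "\<H> \<subseteq> factors X F (leaves v)" "\<H>' \<subseteq> factors X F (leaves v)" "\<H> \<noteq> \<H>'"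
  shows "\<exists>a. eval a (sdd_constr X F v \<H>) \<noteq> eval a (sdd_constr X F v \<H>')"
proof (rule ccontr)
  assume "\<not> ?thesis"
  then have eval_eq: "(\<exists>H \<in> \<H>. H ((Some \<circ> a) |` leaves v)) \<longleftrightarrow>
      (\<exists>H \<in> \<H>'. H ((Some \<circ> a) |` leaves v))" for a
    using eval_sdd_constr[OF assms(1-3)] assms(4,5) by blast
  have eq: "(\<exists>H \<in> \<H>. H b) \<longleftrightarrow> (\<exists>H \<in> \<H>'. H b)" if "b \<in> assignments (leaves v)" for b
    using eval_eq[of "the \<circ> b"] assignment_eq_restrict[OF that] by simp
  have "\<G> \<subseteq> \<G>'" if G: "\<G> \<subseteq> factors X F (leaves v)" "\<G>' \<subseteq> factors X F (leaves v)"
    "\<And>b. b \<in> assignments (leaves v) \<Longrightarrow> (\<exists>H \<in> \<G>. H b) \<longleftrightarrow> (\<exists>H \<in> \<G>'. H b)" for \<G> \<G>'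
  proof
    fix H assume H: "H \<in> \<G>"
    then obtain b where b: "b \<in> assignments (leaves v)" "H b"
      using factor_satisfiable[of "leaves v" X H F] assms(3) G(1) by blast
    then obtain H' where H': "H' \<in> \<G>'" "H' b"
      using G(3) H by blast
    have "H = factor_of X F (leaves v) b" "H' = factor_of X F (leaves v) b"
      using factor_eq_factor_of[of "leaves v" X _ F b] assms(3) H H' b G(1,2) by blast+
    then show "H \<in> \<G>'"
      using H' by simp
  qed
  from this[of \<H> \<H>'] this[of \<H>' \<H>] have "\<H> = \<H>'"
    using assms(4,5) eq by blast
  then show False
    using assms(6) by contradiction
qed

section \<open>Canonicity of the construction\<close>

lemma gates_decision:
  "gates (decision D) =
    insert (decision D) (\<Union>(P, S) \<in> fset D. insert (And [P, S]) (gates P \<union> gates S))"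
  by (force simp: decision_def)

text \<open>Canonicity speaks about any \<open>D\<close> whose decision is a gate; injectivity
  identifies this \<open>D\<close> with the one the gate was built from.\<close>

lemma decision_inject: "decision D = decision D' \<longleftrightarrow> D = D'"
proof -
  have "inj (\<lambda>(P, S). And [P, S])"
    by (auto intro: injI)
  then show ?thesis
    using inj_eq[OF fset.inj_map] by (simp add: decision_def)
qed

lemma sdd_nnf:
  assumes "sdd T C"
  shows "nnf C"
  using assms by cases (auto simp: nnf_def)

lemma sdd_deterministic:
  assumes "sdd T C"
  shows "deterministic C"
  using assms by cases (auto simp: deterministic_def)

lemma nodes_self: "T \<in> nodes T"
  by (cases T) auto

lemma nodes_trans: "v \<in> nodes T \<Longrightarrow> nodes v \<subseteq> nodes T"
  by (induction T) auto

lemma leaves_mono_nodes: "v \<in> nodes T \<Longrightarrow> leaves v \<subseteq> leaves T"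
  by (induction T) auto

lemma sdd_vars:
  assumes "sdd T C"
  shows "vars C \<subseteq> leaves T"
  using assms
proof cases
  case (sdd_decision D w w')
  have "vars P \<subseteq> leaves w" "vars S \<subseteq> leaves w'" if "(P, S) |\<in>| D" for P S
    using sdd_decision(5)[OF that] by (auto simp: structured_by_def)
  then have "vars C \<subseteq> leaves (Node w w')"
    unfolding sdd_decision(1) vars_def by (fastforce simp: gates_decision decision_def)
  then show ?thesis
    using leaves_mono_nodes[OF sdd_decision(4)] by blast
qed (auto simp: vars_def)

text \<open>The circuit conditions of \<open>sdd_decision\<close> are inherited: negations occur
  only inside primes and subs, the top disjuncts exclude each other because their primes do, and
  \<open>sdd_vars\<close> yields structuredness.\<close>

lemma sdd_decisionI:
  assumes node: "Node w w' \<in> nodes T"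
    and P: "\<And>P S. (P, S) |\<in>| D \<Longrightarrow> sdd w P"
    and S: "\<And>P S. (P, S) |\<in>| D \<Longrightarrow> sdd w' S"
    and total: "\<And>a. \<exists>P S. (P, S) |\<in>| D \<and> eval a P"
    and disj: "\<And>a P S P' S'. \<lbrakk>(P, S) |\<in>| D; (P', S') |\<in>| D; (P, S) \<noteq> (P', S')\<rbrakk>
        \<Longrightarrow> \<not> (eval a P \<and> eval a P')"
  shows "sdd T (decision D)"
proof (rule sdd.sdd_decision[OF _ _ node])
  show "nnf (decision D)"
    unfolding nnf_def
  proof (intro allI impI)
    fix h assume "Neg h \<in> gates (decision D)"
    then obtain Q R where "(Q, R) |\<in>| D" "Neg h \<in> gates Q \<union> gates R"
      by (auto simp: gates_decision) (auto simp: decision_def)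
    then show "(\<exists>x. h = Var x) \<or> (\<exists>c. h = Const c)"
      using sdd_nnf[OF P] sdd_nnf[OF S] unfolding nnf_def by blast
  qed
  show "deterministic (decision D)"
    unfolding deterministic_def
  proof (intro allI impI)
    fix Hs h h'
    assume Hs: "Or Hs \<in> gates (decision D)" and h: "h |\<in>| Hs" "h' |\<in>| Hs" "h \<noteq> h'"
    consider "Or Hs = decision D" | Q R where "(Q, R) |\<in>| D" "Or Hs \<in> gates Q \<union> gates R"
      using Hs by (auto simp: gates_decision)
    then show "\<nexists>a. eval a h \<and> eval a h'"
    proof cases
      case 1
      then obtain Q R Q' R' where "(Q, R) |\<in>| D" "(Q', R') |\<in>| D" "h = And [Q, R]" "h' = And [Q', R']"
        using h(1,2) by (auto simp: decision_def)
      then show ?thesis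
        using disj h(3) by fastforce
    next
      case 2
      then show ?thesis
        using sdd_deterministic[OF P] sdd_deterministic[OF S] h
        unfolding deterministic_def by blast
    qed
  qed
  show "structured_by (And [Q, R]) (Node w w')" if "(Q, R) |\<in>| D" for Q R
    using sdd_vars[OF P[OF that]] sdd_vars[OF S[OF that]] by (simp add: structured_by_def)
qed (fact P S total disj)+

lemma canonical_sdd_decisionI:
  assumes "sdd T (decision D)"
    and "\<And>P S. (P, S) |\<in>| D \<Longrightarrow> canonical_sdd w P"
    and "\<And>P S. (P, S) |\<in>| D \<Longrightarrow> canonical_sdd w' S"
    and "\<And>P S P' S'. \<lbrakk>(P, S) |\<in>| D; (P', S') |\<in>| D; (P, S) \<noteq> (P', S')\<rbrakk>
        \<Longrightarrow> \<exists>a. eval a S \<noteq> eval a S'"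
  shows "canonical_sdd T (decision D)"
  unfolding canonical_sdd_def
proof (intro conjI allI impI)
  fix E P S P' S'
  assume E: "decision E \<in> gates (decision D)"
    and PS: "(P, S) |\<in>| E" "(P', S') |\<in>| E" "(P, S) \<noteq> (P', S')"
  have "decision E \<noteq> And [Q, R]" for Q R
    by (simp add: decision_def)
  then consider "E = D" | Q R where "(Q, R) |\<in>| D" "decision E \<in> gates Q \<union> gates R"
    using E by (auto simp: gates_decision decision_inject)
  then show "\<exists>a. eval a S \<noteq> eval a S'"
  proof cases
    case 1
    then show ?thesis
      using assms(4) PS by blast
  next
    case 2
    then show ?thesis
      using assms(2,3) PS unfolding canonical_sdd_def by blast
  qed
qed (fact assms(1))

lemma canonical_sdd_atom:
  assumes "sdd T C" "C \<in> {Const c, Var x, Neg (Var x)}"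
  shows "canonical_sdd T C"
  using assms by (auto simp: canonical_sdd_def decision_def)

text \<open>Every assignment belongs to a class and every class to a prime set, so the primes cover;
  fibres are disjoint, so primes exclude each other; distinct sub sets compute distinct functions,
  so subs are inequivalent.\<close>

lemma canonical_sdd_constr:
  assumes "finite X" "distinct (leaf_list v)" "leaves v \<subseteq> X" "\<H> \<subseteq> factors X F (leaves v)"
  shows "canonical_sdd v (sdd_constr X F v \<H>)"
  using assms(2-4)
proof (induction v arbitrary: \<H>)
  case (Leaf x)
  have "canonical_sdd (Leaf x) (Const c)" for c
    by (intro canonical_sdd_atom[of _ _ c] sdd.intros) simp
  moreover have "canonical_sdd (Leaf x) (Var x)" "canonical_sdd (Leaf x) (Neg (Var x))"
    by (intro canonical_sdd_atom[of _ _ _ x] sdd.intros; simp)+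
  ultimately show ?case
    by (simp add: Let_def)
next
  case (Node w w')
  have sub: "leaves w \<subseteq> X" "leaves w' \<subseteq> X"
    and dist: "distinct (leaf_list w)" "distinct (leaf_list w')"
    using Node.prems by (auto simp: leaves_def)
  define sdH where "sdH = sd X F \<H> (leaves w) (leaves w')"
  define D where "D = Abs_fset ((\<lambda>(P, S). (sdd_constr X F w P, sdd_constr X F w' S)) ` sdH)"
  have D: "fset D = (\<lambda>(P, S). (sdd_constr X F w P, sdd_constr X F w' S)) ` sdH"
    unfolding D_def sdH_def by (rule fset_Abs_fset_sd_image[OF assms(1) sub(1)])
  have D_mem: "\<exists>\<P> \<S>. (\<P>, \<S>) \<in> sdH \<and> \<P> \<subseteq> factors X F (leaves w) \<and> \<S> \<subseteq> factors X F (leaves w')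
      \<and> P = sdd_constr X F w \<P> \<and> S = sdd_constr X F w' \<S>" if PS: "(P, S) |\<in>| D" for P S
  proof -
    obtain \<P> \<S> where "(\<P>, \<S>) \<in> sdH" "P = sdd_constr X F w \<P>" "S = sdd_constr X F w' \<S>"
      using PS D by auto
    moreover from this(1) have "\<P> \<subseteq> factors X F (leaves w)" "\<S> \<subseteq> factors X F (leaves w')"
      unfolding sdH_def by (rule sd_subset_factors)+
    ultimately show ?thesis
      by blast
  qed
  have P: "canonical_sdd w P" and S: "canonical_sdd w' S" if "(P, S) |\<in>| D" for P S
    using D_mem[OF that] Node.IH(1)[OF dist(1) sub(1)] Node.IH(2)[OF dist(2) sub(2)]
    by auto
  have total: "\<exists>P S. (P, S) |\<in>| D \<and> eval a P" for a
  proof -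
    define b where "b = (Some \<circ> a) |` leaves w"
    define G where "G = factor_of X F (leaves w) b"
    have G: "G \<in> factors X F (leaves w)" "G b"
      unfolding G_def b_def
      by (intro factor_of_in_factors factor_of_self sub restrict_in_assignments)+
    then obtain \<P> \<S> where PS: "(\<P>, \<S>) \<in> sdH" "G \<in> \<P>"
      unfolding sdH_def sd_def by blast
    then have "eval a (sdd_constr X F w \<P>)"
      using eval_sdd_constr[OF assms(1) dist(1) sub(1) sd_subset_factors(1)] G(2)
      unfolding sdH_def b_def by blast
    moreover have "(sdd_constr X F w \<P>, sdd_constr X F w' \<S>) |\<in>| D"
      using PS(1) D by force
    ultimately show ?thesis
      by blast
  qed
  \<comment> \<open>Contrapositive of disjointness: a common model \<open>a\<close> lies in a single
    class, which then belongs to both prime sets.\<close>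
  have disj: "(P, S) = (P', S')"
    if PS: "(P, S) |\<in>| D" "(P', S') |\<in>| D" "eval a P" "eval a P'" for a P S P' S'
  proof -
    obtain \<P> \<S> where 1: "(\<P>, \<S>) \<in> sdH" "\<P> \<subseteq> factors X F (leaves w)"
      "P = sdd_constr X F w \<P>" "S = sdd_constr X F w' \<S>"
      using D_mem[OF PS(1)] by blast
    obtain \<P>' \<S>' where 2: "(\<P>', \<S>') \<in> sdH" "\<P>' \<subseteq> factors X F (leaves w)"
      "P' = sdd_constr X F w \<P>'" "S' = sdd_constr X F w' \<S>'"
      using D_mem[OF PS(2)] by blast
    define b where "b = (Some \<circ> a) |` leaves w"
    obtain G where G: "G \<in> \<P>" "G b"
      using PS(3) 1(2,3) eval_sdd_constr[OF assms(1) dist(1) sub(1)] unfolding b_def by blast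
    obtain G' where G': "G' \<in> \<P>'" "G' b"
      using PS(4) 2(2,3) eval_sdd_constr[OF assms(1) dist(1) sub(1)] unfolding b_def by blast
    have "G = factor_of X F (leaves w) b" "G' = factor_of X F (leaves w) b"
      using factor_eq_factor_of[of "leaves w" X _ F b] sub(1) G G' 1(2) 2(2) by blast+
    then have "G \<in> \<P>'"
      using G'(1) by simp
    then have "\<P> = \<P>'" "\<S> = \<S>'"
      using sd_eq_if_common_prime[OF 1(1)[unfolded sdH_def] 2(1)[unfolded sdH_def] G(1)] by blast+
    then show ?thesis
      using 1 2 by simp
  qed
  have subs: "\<exists>a. eval a S \<noteq> eval a S'"
    if PS: "(P, S) |\<in>| D" "(P', S') |\<in>| D" "(P, S) \<noteq> (P', S')" for P S P' S'
  proof -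
    obtain \<P> \<S> where 1: "(\<P>, \<S>) \<in> sdH" "\<S> \<subseteq> factors X F (leaves w')"
      "P = sdd_constr X F w \<P>" "S = sdd_constr X F w' \<S>"
      using D_mem[OF PS(1)] by blast
    obtain \<P>' \<S>' where 2: "(\<P>', \<S>') \<in> sdH" "\<S>' \<subseteq> factors X F (leaves w')"
      "P' = sdd_constr X F w \<P>'" "S' = sdd_constr X F w' \<S>'"
      using D_mem[OF PS(2)] by blast
    \<comment> \<open>Equal sub sets would force equal prime sets, hence the same pair of
      circuits.\<close>
    have "\<S> \<noteq> \<S>'"
      using PS(3) 1 2 sd_eq_if_same_sub unfolding sdH_def by blast
    then show ?thesis
      using sdd_constr_inequivalent[OF assms(1) dist(2) sub(2) 1(2) 2(2)] 1(4) 2(4) by simp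
  qed
  have "sdd (Node w w') (decision D)"
  proof (rule sdd_decisionI)
    show "Node w w' \<in> nodes (Node w w')"
      by simp
    show "sdd w P" "sdd w' S" if "(P, S) |\<in>| D" for P S
      using P[OF that] S[OF that] by (simp_all add: canonical_sdd_def)
    show "\<not> (eval a P \<and> eval a P')"
      if "(P, S) |\<in>| D" "(P', S') |\<in>| D" "(P, S) \<noteq> (P', S')" for a P S P' S'
      using disj[OF that(1,2)] that(3) by blast
  qed (rule total)
  then have "canonical_sdd (Node w w') (decision D)"
    using P S subs by (rule canonical_sdd_decisionI)
  then show ?case
    by (simp add: D_def sdH_def)
qed

text \<open>The constant \<open>\<bottom>\<close> is not a factor of itself, so \<open>{F}\<close> is not a set of factors in that case.\<close>

lemma sdd_constr_bot:
  assumes "leaves v \<subseteq> X"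
  shows "sdd_constr X F v {\<lambda>_. False} = sdd_constr X F v {}"
proof (cases v)
  case (Leaf x)
  \<comment> \<open>Neither set passes a leaf test: \<open>factors X F {x}\<close> is nonempty and
    its members are satisfiable, so both sets fall through to \<open>Const False\<close>.\<close>
  have "(\<lambda>b. b = [x \<mapsto> c]) \<noteq> (\<lambda>_. False)" "(\<lambda>_. False) \<noteq> (\<lambda>b. b = [x \<mapsto> c])" for c :: bool
    by (metis (mono_tags))+
  moreover have "{} \<noteq> factors X F {x}" "{\<lambda>_. False} \<noteq> factors X F {x}"
    using factor_satisfiable[of "{x}" X] factor_of_in_factors[of "{x}" X "[x \<mapsto> True]"] assms Leaf
    by (auto simp: assignments_def)
  ultimately show ?thesis
    by (simp add: Leaf Let_def)
next
  case (Node w w')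
  \<comment> \<open>Factors are satisfiable, so no product of two of them fits into the empty set of
    models; both sets thus give the same \<open>sd\<close>.\<close>
  have "(G, G') \<notin> impl X F (\<lambda>_. False) (leaves w) (leaves w')" for G G'
    using factor_satisfiable[of "leaves w" X G F] factor_satisfiable[of "leaves w'" X G' F] assms Node
    by (auto simp: impl_def sat_def)
  then have "sd_sub X F {\<lambda>_. False} (leaves w) (leaves w') = sd_sub X F {} (leaves w) (leaves w')"
    by (auto simp: sd_sub_def)
  then show ?thesis
    by (simp add: Node sd_def)
qed

text \<open>Once all variables are assigned, a cofactor records only the value of \<open>F\<close>,
  so the class of a model is the set of all models.\<close>

lemma boolfun_in_factors:
  assumes "F \<in> boolfuns X" "F b"
  shows "F \<in> factors X F X"
proof -
  have b: "b \<in> assignments X"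
    using assms by (auto simp: boolfuns_def)
  have "cofactor X F X c = (\<lambda>e. e = Map.empty \<and> F c)" for c
    unfolding cofactor_def assignments_def by (rule ext) auto
  then have "factor_of X F X b = F"
    using assms by (auto simp: factor_of_def fun_eq_iff boolfuns_def)
  then show ?thesis
    using factor_of_in_factors[of X X b F] b by simp
qed

lemma sdd_of_canonical_computes:
  assumes "finite X" "vtree_for X T" "F \<in> boolfuns X"
  shows "canonical_sdd T (sdd_of X F T)" "computes (sdd_of X F T) X F"
proof -
  have T: "distinct (leaf_list T)" "leaves T = X"
    using assms(2) by (auto simp: vtree_for_def)
  \<comment> \<open>\<open>\<H>\<close> is \<open>{F}\<close> if \<open>F\<close> is satisfiable and
    \<open>{}\<close> otherwise; in both cases it is a set of factors whose union is
    \<open>F\<close>.\<close>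
  obtain \<H> where \<H>: "\<H> \<subseteq> factors X F (leaves T)" "sdd_of X F T = sdd_constr X F T \<H>"
    "\<And>b. (\<exists>H \<in> \<H>. H b) \<longleftrightarrow> F b"
  proof (cases "\<exists>b. F b")
    case True
    then show ?thesis
      using that[of "{F}"] boolfun_in_factors[OF assms(3)] T by (auto simp: sdd_of_def)
  next
    case False
    then have "F = (\<lambda>_. False)"
      by auto
    then show ?thesis
      using that[of "{}"] sdd_constr_bot[of T X F] T by (auto simp: sdd_of_def)
  qed
  show can: "canonical_sdd T (sdd_of X F T)"
    using canonical_sdd_constr[OF assms(1) T(1) _ \<H>(1)] \<H>(2) T by simp
  then have "vars (sdd_of X F T) \<subseteq> X"
    using sdd_vars T by (auto simp: canonical_sdd_def)
  then show "computes (sdd_of X F T) X F"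
    using eval_sdd_constr[OF assms(1) T(1) _ \<H>(1)] \<H>(2,3) T by (simp add: computes_def)
qed

section \<open>Size\<close>

lemma finite_gates: "finite (gates C)"
  by (induction C) auto

lemma finite_nodes: "finite (nodes T)"
  by (induction T) auto

text \<open>Only an inequality, since equal subtrees at different positions are one element of
  \<open>nodes T\<close>.\<close>

lemma card_nodes: "card (nodes T) \<le> 2 * length (leaf_list T) - 1"
proof (induction T)
  case (Node l r)
  have "length (leaf_list t) \<ge> 1" for t :: "'a vtree"
    by (induction t) auto
  from this[of l] this[of r] have
    "card (nodes l \<union> nodes r) + 1 \<le> 2 * length (leaf_list (Node l r)) - 1"
    using Node card_Un_le[of "nodes l" "nodes r"] by simp
  moreover have "card (nodes (Node l r)) \<le> card (nodes l \<union> nodes r) + 1"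
    by (simp add: card_insert_if finite_nodes)
  ultimately show ?case
    by linarith
qed simp

text \<open>A decision other than the output occurs as a prime or sub. In the induction, the
  alternative that \<open>g\<close> is the whole subcircuit thus turns into \<open>g\<close> being
  an input of an \<open>And\<close>-gate.\<close>

lemma sdd_gate_cases:
  assumes "sdd T C" "g \<in> gates C"
  shows "g = C \<or> g \<in> range Const \<or> g \<in> Var ` leaves T \<or> g \<in> (Neg \<circ> Var) ` leaves T
    \<or> (\<exists>v \<in> nodes T. structured_by g v) \<or> (\<exists>h. And [g, h] \<in> gates C \<or> And [h, g] \<in> gates C)"
  using assms
proof (induction arbitrary: g)
  case (sdd_decision D w w' T)
  have nodes: "w \<in> nodes T" "w' \<in> nodes T"
    using nodes_trans[OF sdd_decision.hyps(3)] nodes_self by auto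
  have sub: "leaves w \<subseteq> leaves T" "leaves w' \<subseteq> leaves T" "nodes w \<subseteq> nodes T" "nodes w' \<subseteq> nodes T"
    by (intro leaves_mono_nodes nodes_trans nodes)+
  consider "g = decision D" | P S where "(P, S) |\<in>| D" "g = And [P, S]"
    | P S where "(P, S) |\<in>| D" "g \<in> gates P" | P S where "(P, S) |\<in>| D" "g \<in> gates S"
    using sdd_decision.prems by (auto simp: gates_decision)
  then show ?case
  proof cases
    case 2
    then show ?thesis
      using sdd_decision.hyps(3,4) by blast
  next
    case 3
    then have "gates P \<subseteq> gates (decision D)" "And [P, S] \<in> gates (decision D)"
      by (auto simp: gates_decision)
    then show ?thesis
      using sdd_decision.IH(1)[OF 3] sub by blast
  next
    case 4
    then have "gates S \<subseteq> gates (decision D)" "And [P, S] \<in> gates (decision D)"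
      by (auto simp: gates_decision)
    then show ?thesis
      using sdd_decision.IH(2)[OF 4] sub by blast
  qed simp
qed auto

text \<open>Ensures that counting the gates structured by nodes of \<open>T\<close> counts every
  \<open>And\<close>-gate, so that all inputs can be charged to them.\<close>

lemma sdd_And_structured:
  assumes "sdd T C" "And Cs \<in> gates C"
  shows "\<exists>v \<in> nodes T. structured_by (And Cs) v"
  using assms
proof (induction)
  case (sdd_decision D w w' T)
  have sub: "nodes w \<subseteq> nodes T" "nodes w' \<subseteq> nodes T"
    using nodes_trans[OF sdd_decision.hyps(3)] nodes_self by auto
  have "And Cs \<noteq> decision D"
    by (simp add: decision_def)
  then obtain P S where PS: "(P, S) |\<in>| D" "And Cs \<in> insert (And [P, S]) (gates P \<union> gates S)"
    using sdd_decision.prems by (auto simp: gates_decision)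
  then show ?case
    using sdd_decision.IH[OF PS(1)] sdd_decision.hyps(3) sdd_decision.hyps(4)[OF PS(1)] sub
    by blast
qed auto

text \<open>The gates are covered by the output, two constants, two literals per leaf, the
  structured gates, and the two inputs of each of these.\<close>

lemma sdd_size_le:
  assumes sdd: "sdd T C"
    and width: "\<And>v. v \<in> nodes T \<Longrightarrow> card {g \<in> gates C. structured_by g v} \<le> k"
  shows "circuit_size C \<le> 3 + 2 * card (leaves T) + 3 * (card (nodes T) * k)"
proof -
  define A where "A = (\<Union>v \<in> nodes T. {g \<in> gates C. structured_by g v})"
  \<comment> \<open>Every gate in \<open>A\<close> is an \<open>And\<close> of two inputs, so
    \<open>hd\<close> and \<open>last\<close> of its \<open>args\<close> are its left and right
    input.\<close>
  define args :: "'a circuit \<Rightarrow> 'a circuit list" where "args g = (case g of And Cs \<Rightarrow> Cs)" for g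
  have finA: "finite A"
    unfolding A_def by (simp add: finite_nodes finite_gates)
  have cardA: "card A \<le> card (nodes T) * k"
  proof -
    have "card A \<le> (\<Sum>v \<in> nodes T. card {g \<in> gates C. structured_by g v})"
      unfolding A_def by (rule card_UN_le[OF finite_nodes])
    also have "\<dots> \<le> of_nat (card (nodes T)) * k"
      using width by (rule sum_bounded_above)
    finally show ?thesis
      by simp
  qed
  let ?atoms = "insert C {Const False, Const True}"
  let ?lits = "Var ` leaves T \<union> (Neg \<circ> Var) ` leaves T"
  let ?inputs = "(hd \<circ> args) ` A \<union> (last \<circ> args) ` A"
  have "gates C \<subseteq> ?atoms \<union> ?lits \<union> A \<union> ?inputs"
  proof
    fix g assume g: "g \<in> gates C"
    have And_in_A: "And Cs \<in> A" if "And Cs \<in> gates C" for Cs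
      using sdd_And_structured[OF sdd that] that by (simp add: A_def)
    have "g \<in> ?inputs" if input: "\<exists>h. And [g, h] \<in> gates C \<or> And [h, g] \<in> gates C"
    proof -
      obtain h where "And [g, h] \<in> A \<or> And [h, g] \<in> A"
        using input And_in_A by blast
      then show ?thesis
        by (force simp: args_def)
    qed
    moreover have "g \<in> ?atoms" if "g \<in> range Const"
      using that by (auto simp: UNIV_bool)
    moreover have "g \<in> A" if "\<exists>v \<in> nodes T. structured_by g v"
      using that g by (auto simp: A_def)
    ultimately show "g \<in> ?atoms \<union> ?lits \<union> A \<union> ?inputs"
      using sdd_gate_cases[OF sdd g] by (elim disjE) (simp_all only: Un_iff insert_iff simp_thms)
  qed
  then have "card (gates C) \<le> card (?atoms \<union> ?lits \<union> A \<union> ?inputs)"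
    by (intro card_mono) (simp_all add: finA leaves_def)
  also have "\<dots> \<le> card ?atoms + card ?lits + card A + card ?inputs"
    by (meson add_le_mono card_Un_le order_refl order_trans)
  also have "card ?atoms \<le> 3"
    by (simp add: card_insert_if)
  also have "card ?lits \<le> card (leaves T) + card (leaves T)"
    by (intro order_trans[OF card_Un_le] add_mono card_image_le) (simp_all add: leaves_def)
  also have "card ?inputs \<le> card A + card A"
    by (intro order_trans[OF card_Un_le] add_mono card_image_le finA)
  finally show ?thesis
    unfolding circuit_size_def using cardA by simp
qed

section \<open>Optimal vtrees and the final bound\<close>

lemma ex_vtree_for:
  assumes "finite X" "X \<noteq> {}"
  shows "\<exists>T. vtree_for X T"
  using assms
proof (induction rule: finite_ne_induct)
  case (singleton x)
  have "vtree_for {x} (Leaf x)"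
    by (simp add: vtree_for_def)
  then show ?case ..
next
  case (insert x X)
  then obtain T where "vtree_for X T"
    by blast
  then have "vtree_for (insert x X) (Node (Leaf x) T)"
    using insert.hyps by (auto simp: vtree_for_def leaves_def)
  then show ?case ..
qed

text \<open>\<open>LEAST\<close> is attained because some vtree exists, so the set of candidate
  widths is nonempty.\<close>

lemma sdw_attained:
  assumes "finite X" "X \<noteq> {}"
  shows "\<exists>T. vtree_for X T \<and> sdw_vtree X F T = sdw X F"
  unfolding sdw_def
  by (rule LeastI_ex[of "\<lambda>k. \<exists>T. vtree_for X T \<and> sdw_vtree X F T = k"])
    (use ex_vtree_for[OF assms] in blast)

(* Variables range over the fixed infinite type nat so that c cannot depend on a type variable.
   If card X = 1 the only vtree has no inner node and the SDD width is 0, while every circuit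
   has a gate; hence max 1 k. If card X >= 2 the width is at least 1 and max 1 k = k. *)
theorem theorem4:
  "\<exists>c::nat. \<forall>(X :: nat set) (F :: nat boolfun) (k :: nat) (n :: nat).
     finite X \<longrightarrow> X \<noteq> {} \<longrightarrow> card X = n \<longrightarrow> F \<in> boolfuns X \<longrightarrow> sdw X F = k \<longrightarrow>
     (\<exists>T C. vtree_for X T \<and> canonical_sdd T C \<and> computes C X F \<and>
        circuit_size C \<le> c * max 1 k * n)"
proof (intro exI[of _ 11] allI impI)
  fix X :: "nat set" and F :: "nat boolfun" and k n :: nat
  assume X: "finite X" "X \<noteq> {}" "card X = n" and F: "F \<in> boolfuns X" and k: "sdw X F = k"
  obtain T where T: "vtree_for X T" "sdw_vtree X F T = k"
    using sdw_attained[OF X(1,2)] k by blast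
  let ?C = "sdd_of X F T"
  have C: "canonical_sdd T ?C" "computes ?C X F"
    using sdd_of_canonical_computes[OF X(1) T(1) F] by blast+
  have "card {g \<in> gates ?C. structured_by g v} \<le> k" if "v \<in> nodes T" for v
    unfolding T(2)[symmetric] sdw_vtree_def using that finite_nodes by (intro Max_ge) auto
  then have size: "circuit_size ?C \<le> 3 + 2 * card (leaves T) + 3 * (card (nodes T) * k)"
    using sdd_size_le C(1) unfolding canonical_sdd_def by blast
  have leaves: "card (leaves T) = n" "length (leaf_list T) = n"
    using T(1) X(3) by (auto simp: vtree_for_def leaves_def distinct_card)
  have "n \<ge> 1"
    using X card_gt_0_iff[of X] by linarith
  \<comment> \<open>The factor \<open>max 1 k\<close> absorbs the terms of the size bound that lack
    \<open>k\<close>, even for \<open>k = 0\<close>.\<close>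
  then have n: "n \<le> n * max 1 k" "1 \<le> n * max 1 k"
    by auto
  have "card (nodes T) * k \<le> (2 * n) * max 1 k"
    using card_nodes[of T] leaves by (intro mult_mono) auto
  \<comment> \<open>\<open>11 = 3 + 2 + 3 * 2\<close>: output and constants, literals, and three
    gates for each of the at most \<open>2 * n * max 1 k\<close> structured
    \<open>And\<close>-gates.\<close>
  then have "circuit_size ?C \<le> 11 * (n * max 1 k)"
    using size leaves n by linarith
  then show "\<exists>T C. vtree_for X T \<and> canonical_sdd T C \<and> computes C X F \<and>
        circuit_size C \<le> 11 * max 1 k * n"
    using T(1) C by (auto simp: ac_simps)
qed

end
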